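(* Let $\mathbb{X}$ be a Euclidean space, let $f,g:\mathbb{X}\to\mathbb{R}\cup\{+\infty\}$ be proper lower semicontinuous convex functions, and let $\bar x\in\operatorname{int}(\operatorname{dom} f)\cap\operatorname{dom} g$ be a minimizer of $f+g$ over $\mathbb{X}$. Suppose that $f$ is twice continuously differentiable in $\operatorname{int}(\operatorname{dom} f)$ and that $\partial g$ is metrically subregular at $\bar x$ for $\bar v=-\nabla f(\bar x)$. Then $\bar x$ is a strong solution of $\min_{x\in\mathbb{X}} f(x)+g(x)$ if and only if $$\operatorname{Ker}\nabla^2 f(\bar x)\cap T_{\partial g^*(\bar v)}(\bar x)=\{0\}.$$
   Context: $\partial g$ is the convex subdifferential and $g^*(v)=\sup_x\{\langle v,x\rangle-g(x)\}$ is the Fenchel conjugate; $\partial g^*(\bar v)=(\partial g)^{-1}(\bar v)$. $\partial g$ is metrically subregular at $\bar x$ for $\bar v\in\partial g(\bar x)$ if there exist $\eta,\ell>0$ such that $\operatorname{dist}(x;(\partial g)^{-1}(\bar v))\le\ell\,\operatorname{dist}(\bar v;\partial g(x))$ for all $x\in\mathbb{B}_\eta(\bar x)$ (with $\operatorname{dist}(\cdot;\emptyset)=+\infty$). A point $\bar x$ is a strong solution of $\min\varphi$ if there exist $c,\varepsilon>0$ such that $\varphi(x)-\varphi(\bar x)\ge c\|x-\bar x\|^2$ for all $x\in\mathbb{B}_\varepsilon(\bar x)$ (the closed ball). The contingent cone to a closed set $K$ at $\bar x\in K$ is $T_K(\bar x)=\{w\mid\exists\, t_k\downarrow0,\ w_k\to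 w,\ \bar x+t_kw_k\in K\}$. *)

theory Defs
  imports "HOL-Analysis.Analysis"
begin

section \<open>Extended-real-valued functions\<close>

definition edom :: "('a \<Rightarrow> ereal) \<Rightarrow> 'a set" where
  "edom f = {x. f x < \<infinity>}"

definition proper :: "('a \<Rightarrow> ereal) \<Rightarrow> bool" where
  "proper f \<longleftrightarrow> (\<forall>x. f x \<noteq> -\<infinity>) \<and> edom f \<noteq> {}"

definition lower_semicontinuous :: "('a::topological_space \<Rightarrow> ereal) \<Rightarrow> bool" where
  "lower_semicontinuous f \<longleftrightarrow> (\<forall>x. f x \<le> Liminf (at x) f)"

text \<open>The weights are strictly between 0 and 1, so that no product \<open>0 * \<infinity>\<close> occurs. The notion is
  only used for functions that never take the value \<open>-\<infinity>\<close>.\<close>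

definition convex_efun :: "('a::real_vector \<Rightarrow> ereal) \<Rightarrow> bool" where
  "convex_efun f \<longleftrightarrow> (\<forall>x y t. 0 < t \<and> t < 1 \<longrightarrow>
     f ((1 - t) *\<^sub>R x + t *\<^sub>R y) \<le> ereal (1 - t) * f x + ereal t * f y)"

definition is_minimizer :: "('a \<Rightarrow> ereal) \<Rightarrow> 'a \<Rightarrow> bool" where
  "is_minimizer \<phi> x \<longleftrightarrow> (\<forall>y. \<phi> x \<le> \<phi> y)"

text \<open>Finiteness of \<open>\<phi> x\<close> is required because \<open>\<infinity> - \<infinity> = \<infinity>\<close> in \<^typ>\<open>ereal\<close>.\<close>

definition strong_solution :: "('a::real_normed_vector \<Rightarrow> ereal) \<Rightarrow> 'a \<Rightarrow> bool" where
  "strong_solution \<phi> x \<longleftrightarrow> \<bar>\<phi> x\<bar> \<noteq> \<infinity> \<and>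
     (\<exists>c>0. \<exists>\<epsilon>>0. \<forall>y\<in>cball x \<epsilon>. \<phi> y - \<phi> x \<ge> ereal (c * (norm (y - x))\<^sup>2))"

section \<open>Convex duality\<close>

definition subdifferential :: "('a::real_inner \<Rightarrow> ereal) \<Rightarrow> 'a \<Rightarrow> 'a set" where
  "subdifferential g x =
     {v. \<bar>g x\<bar> \<noteq> \<infinity> \<and> (\<forall>y. g x + ereal (v \<bullet> (y - x)) \<le> g y)}"

definition fenchel_conjugate :: "('a::real_inner \<Rightarrow> ereal) \<Rightarrow> 'a \<Rightarrow> ereal" where
  "fenchel_conjugate g v = (SUP x. ereal (v \<bullet> x) - g x)"

section \<open>Set-valued maps and tangents\<close>

text \<open>Unlike \<^const>\<open>infdist\<close>, the distance to the empty set is \<open>\<infinity>\<close>.\<close>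

definition edist_set :: "'a::metric_space \<Rightarrow> 'a set \<Rightarrow> ereal" where
  "edist_set x S = (INF y\<in>S. ereal (dist x y))"

definition setmap_inverse :: "('a \<Rightarrow> 'b set) \<Rightarrow> 'b \<Rightarrow> 'a set" where
  "setmap_inverse F v = {x. v \<in> F x}"

definition metrically_subregular ::
    "('a::metric_space \<Rightarrow> 'b::metric_space set) \<Rightarrow> 'a \<Rightarrow> 'b \<Rightarrow> bool" where
  "metrically_subregular F x v \<longleftrightarrow> v \<in> F x \<and>
     (\<exists>\<eta>>0. \<exists>l>0. \<forall>y\<in>cball x \<eta>.
        edist_set y (setmap_inverse F v) \<le> ereal l * edist_set v (F y))"

definition contingent_cone :: "'a::real_normed_vector set \<Rightarrow> 'a \<Rightarrow> 'a set" where
  "contingent_cone K x =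
     {w. \<exists>(t :: nat \<Rightarrow> real) (u :: nat \<Rightarrow> 'a).
           (\<forall>k. t k > 0) \<and> t \<longlonglongrightarrow> 0 \<and> u \<longlonglongrightarrow> w \<and> (\<forall>k. x + t k *\<^sub>R u k \<in> K)}"

section \<open>Gradient and Hessian\<close>

definition gradient :: "('a::euclidean_space \<Rightarrow> real) \<Rightarrow> 'a \<Rightarrow> 'a" where
  "gradient F x = (THE D. GDERIV F x :> D)"

definition hessian :: "('a::euclidean_space \<Rightarrow> real) \<Rightarrow> 'a \<Rightarrow> 'a \<Rightarrow>\<^sub>L 'a" where
  "hessian F x = Blinfun (frechet_derivative (gradient F) (at x))"

text \<open>To be used for open \<open>S\<close>.\<close>

definition twice_continuously_differentiable_on ::
    "('a::euclidean_space \<Rightarrow> real) \<Rightarrow> 'a set \<Rightarrow> bool" where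
  "twice_continuously_differentiable_on F S \<longleftrightarrow>
     (\<forall>x\<in>S. F differentiable (at x)) \<and>
     (\<forall>x\<in>S. gradient F differentiable (at x)) \<and>
     continuous_on S (hessian F)"

definition blinfun_kernel :: "('a::real_normed_vector \<Rightarrow>\<^sub>L 'b::real_normed_vector) \<Rightarrow> 'a set" where
  "blinfun_kernel A = {w. blinfun_apply A w = 0}"

end

theory Submission
  imports Defs
begin

text \<open>Let \<open>S\<close> be the set of points at which \<open>vbar\<close> is a subgradient of \<open>g\<close>; by biconjugation it equals
  \<open>\<partial>g*(vbar)\<close>, and \<open>g\<close> is affine with slope \<open>vbar\<close> on it, so that \<open>f + g\<close> grows along \<open>S\<close> exactly like the
  second-order Taylor remainder of \<open>f\<close>. This gives necessity. Conversely, if quadratic growth fails,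
  there are \<open>y\<^sub>k \<rightarrow> xbar\<close> with \<open>f + g\<close> exceeding its minimum by only \<open>o(t\<^sub>k\<^sup>2)\<close>, \<open>t\<^sub>k = \<parallel>y\<^sub>k - xbar\<parallel>\<close>. Both
  convex first-order gaps, of \<open>f\<close> and of \<open>g\<close>, are then \<open>o(t\<^sub>k\<^sup>2)\<close>. The gap of \<open>f\<close> puts every limit direction into
  the kernel of the Hessian. The gap of \<open>g\<close> bounds the distance from \<open>y\<^sub>k\<close> to its proximal point \<open>z\<^sub>k\<close> by
  \<open>o(t\<^sub>k)\<close>; as \<open>vbar + y\<^sub>k - z\<^sub>k\<close> is a subgradient at \<open>z\<^sub>k\<close>, metric subregularity yields
  \<open>dist(y\<^sub>k; S) = o(t\<^sub>k)\<close>, so the limit direction is also tangent to \<open>S\<close>.\<close>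

section \<open>Second-order expansion\<close>

lemma GDERIV_gradient:
  fixes F :: "'a::euclidean_space \<Rightarrow> real"
  assumes "F differentiable (at x)"
  shows "GDERIV F x :> gradient F x"
proof -
  obtain L where L: "(F has_derivative L) (at x)"
    using assms unfolding differentiable_def by blast
  then interpret L: bounded_linear L by (rule has_derivative_bounded_linear)
  define D where "D = (\<Sum>b\<in>Basis. L b *\<^sub>R b)"
  have "L h = h \<bullet> D" for h
  proof -
    have "L h = L (\<Sum>b\<in>Basis. (h \<bullet> b) *\<^sub>R b)" by (simp add: euclidean_representation)
    also have "\<dots> = h \<bullet> D"
      by (simp add: L.sum L.scaleR D_def inner_sum_right mult.commute)
    finally show ?thesis .
  qed
  then have D: "GDERIV F x :> D"
    using L unfolding gderiv_def by (metis (no_types, lifting) ext)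
  have "E = D" if "GDERIV F x :> E" for E
  proof -
    have "(\<lambda>h. h \<bullet> E) = (\<lambda>h. h \<bullet> D)"
      using that D unfolding gderiv_def by (rule has_derivative_unique)
    then have "(E - D) \<bullet> (E - D) = 0"
      by (metis inner_diff_right cancel_comm_monoid_add_class.diff_cancel)
    then show ?thesis by simp
  qed
  with D show ?thesis unfolding gradient_def by (rule theI)
qed

lemma gradient_has_derivative_hessian:
  assumes "gradient F differentiable (at x)"
  shows "(gradient F has_derivative hessian F x) (at x)"
proof -
  have *: "(gradient F has_derivative frechet_derivative (gradient F) (at x)) (at x)"
    using assms by (simp add: frechet_derivative_works)
  then have "blinfun_apply (hessian F x) = frechet_derivative (gradient F) (at x)"
    unfolding hessian_def by (intro bounded_linear_Blinfun_apply has_derivative_bounded_linear)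
  with * show ?thesis by simp
qed

lemma DERIV_along_line:
  assumes "F differentiable (at (x + s *\<^sub>R h))"
  shows "((\<lambda>s. F (x + s *\<^sub>R h)) has_real_derivative gradient F (x + s *\<^sub>R h) \<bullet> h) (at s within A)"
proof -
  have "(F has_derivative (\<lambda>k. k \<bullet> gradient F (x + s *\<^sub>R h))) (at (x + s *\<^sub>R h))"
    using GDERIV_gradient[OF assms] by (simp add: gderiv_def)
  then have "((\<lambda>s. F (x + s *\<^sub>R h)) has_derivative (\<lambda>r. (r *\<^sub>R h) \<bullet> gradient F (x + s *\<^sub>R h)))
      (at s within A)"
    by (rule has_derivative_compose[rotated]) (auto intro!: derivative_eq_intros)
  then show ?thesis
    by (simp add: has_field_derivative_def inner_commute mult_commute_abs)
qed

lemma second_order_remainder_bound: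
  fixes F :: "'a::euclidean_space \<Rightarrow> real"
  assumes U: "open U" "x \<in> U"
    and F: "\<And>y. y \<in> U \<Longrightarrow> F differentiable (at y)"
    and F2: "gradient F differentiable (at x)" and e: "0 < e"
  shows "\<exists>d>0. \<forall>h. norm h < d \<longrightarrow>
    \<bar>F (x + h) - F x - gradient F x \<bullet> h - (hessian F x h \<bullet> h) / 2\<bar> \<le> e * (norm h)\<^sup>2"
proof -
  obtain d1 where d1: "d1 > 0" "ball x d1 \<subseteq> U"
    using U open_contains_ball by blast
  obtain d2 where d2: "d2 > 0" "\<And>y. norm (y - x) < d2 \<Longrightarrow>
      norm (gradient F y - gradient F x - hessian F x (y - x)) \<le> e * norm (y - x)"
    using gradient_has_derivative_hessian[OF F2] e unfolding has_derivative_at_alt by blast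
  have "\<bar>F (x + h) - F x - gradient F x \<bullet> h - (hessian F x h \<bullet> h) / 2\<bar> \<le> e * (norm h)\<^sup>2"
    if h: "norm h < min d1 d2" for h
  proof -
    define p where "p s = F (x + s *\<^sub>R h) - s * (gradient F x \<bullet> h) - s\<^sup>2 * (hessian F x h \<bullet> h) / 2" for s
    define p' where "p' s = (gradient F (x + s *\<^sub>R h) - gradient F x - hessian F x (s *\<^sub>R h)) \<bullet> h" for s
    have small: "norm (s *\<^sub>R h) < min d1 d2" if "0 \<le> s" "s \<le> 1" for s
    proof -
      have "norm (s *\<^sub>R h) \<le> 1 * norm h" unfolding norm_scaleR
        using that by (intro mult_right_mono) auto
      with h show ?thesis by simp
    qed
    have der: "(p has_real_derivative p' s) (at s)" if "0 \<le> s" "s \<le> 1" for s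
    proof -
      have "x + s *\<^sub>R h \<in> U" using small[OF that] d1 by (auto simp: dist_norm)
      then show ?thesis unfolding p_def p'_def
        by (auto intro!: derivative_eq_intros DERIV_along_line F
            simp: inner_diff_left inner_add_left blinfun.scaleR_right field_simps)
    qed
    then obtain s where s: "0 < s" "s < 1" "p 1 - p 0 = (1 - 0) * p' s"
      using MVT2[of 0 1 p p'] by auto
    have "\<bar>p' s\<bar> \<le> norm (gradient F (x + s *\<^sub>R h) - gradient F x - hessian F x (s *\<^sub>R h)) * norm h"
      unfolding p'_def by (rule Cauchy_Schwarz_ineq2)
    also have "\<dots> \<le> (e * norm (s *\<^sub>R h)) * norm h"
      using d2(2)[of "x + s *\<^sub>R h"] small[of s] s by (intro mult_right_mono) auto
    also have "\<dots> = s * (e * (norm h)\<^sup>2)" using s by (simp add: power2_eq_square)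
    also have "\<dots> \<le> 1 * (e * (norm h)\<^sup>2)" using s e by (intro mult_right_mono) auto
    finally have "\<bar>p 1 - p 0\<bar> \<le> e * (norm h)\<^sup>2" using s by simp
    then show ?thesis by (simp add: p_def algebra_simps)
  qed
  with d1 d2 show ?thesis by (intro exI[of _ "min d1 d2"]) auto
qed

lemma second_order_quotient_tendsto:
  fixes F :: "'a::euclidean_space \<Rightarrow> real"
  assumes "open U" "x \<in> U" "\<And>y. y \<in> U \<Longrightarrow> F differentiable (at y)"
    and "gradient F differentiable (at x)"
    and t: "\<And>k. t k > 0" "t \<longlonglongrightarrow> 0" and u: "u \<longlonglongrightarrow> w"
  shows "(\<lambda>k. (F (x + t k *\<^sub>R u k) - F x - gradient F x \<bullet> (t k *\<^sub>R u k)) / (t k)\<^sup>2)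
    \<longlonglongrightarrow> (hessian F x w \<bullet> w) / 2"
proof -
  define A where "A k = (F (x + t k *\<^sub>R u k) - F x - gradient F x \<bullet> (t k *\<^sub>R u k)) / (t k)\<^sup>2" for k
  define B where "B k = (hessian F x (u k) \<bullet> u k) / 2" for k
  have tu: "(\<lambda>k. norm (t k *\<^sub>R u k)) \<longlonglongrightarrow> 0"
    using tendsto_norm[OF tendsto_scaleR[OF t(2) u]] by simp
  have nu: "(\<lambda>k. norm (u k)) \<longlonglongrightarrow> norm w" using u by (rule tendsto_norm)
  have "(\<lambda>k. A k - B k) \<longlonglongrightarrow> 0"
  proof (rule tendstoI)
    fix e :: real assume e: "0 < e"
    define e' where "e' = e / (norm w + 1)\<^sup>2"
    have pos: "norm w + 1 > 0" by (smt (verit) norm_ge_zero)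
    have e': "e' > 0" using e pos by (simp add: e'_def)
    obtain d where d: "d > 0" "\<And>h. norm h < d \<Longrightarrow>
       \<bar>F (x + h) - F x - gradient F x \<bullet> h - (hessian F x h \<bullet> h) / 2\<bar> \<le> e' * (norm h)\<^sup>2"
      using second_order_remainder_bound[OF assms(1-4) e'] by blast
    have "\<forall>\<^sub>F k in sequentially. norm (t k *\<^sub>R u k) < d"
      using order_tendstoD(2)[OF tu] d(1) by auto
    moreover have "\<forall>\<^sub>F k in sequentially. norm (u k) < norm w + 1"
      using order_tendstoD(2)[OF nu] by auto
    ultimately show "\<forall>\<^sub>F k in sequentially. dist (A k - B k) 0 < e"
    proof eventually_elim
      case (elim k)
      have "A k - B k = (F (x + t k *\<^sub>R u k) - F x - gradient F x \<bullet> (t k *\<^sub>R u k)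
          - (hessian F x (t k *\<^sub>R u k) \<bullet> (t k *\<^sub>R u k)) / 2) / (t k)\<^sup>2"
        using t(1)[of k] by (simp add: A_def B_def blinfun.scaleR_right field_simps power2_eq_square)
      then have "\<bar>A k - B k\<bar> \<le> e' * (norm (t k *\<^sub>R u k))\<^sup>2 / (t k)\<^sup>2"
        using d(2)[OF elim(1)] by (simp add: divide_right_mono)
      also have "\<dots> = e' * (norm (u k))\<^sup>2" using t(1)[of k] by (simp add: power_mult_distrib)
      also have "\<dots> < e' * (norm w + 1)\<^sup>2"
        using elim(2) e' by (intro mult_strict_left_mono power_strict_mono) auto
      also have "\<dots> = e" using pos by (simp add: e'_def)
      finally show ?case by simp
    qed
  qed
  moreover have "B \<longlonglongrightarrow> (hessian F x w \<bullet> w) / 2"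
    unfolding B_def by (intro tendsto_intros u) auto
  ultimately have "(\<lambda>k. (A k - B k) + B k) \<longlonglongrightarrow> 0 + (hessian F x w \<bullet> w) / 2" by (rule tendsto_add)
  then show ?thesis by (simp add: A_def)
qed

lemma convex_on_imp_above_gradient:
  fixes F :: "'a::euclidean_space \<Rightarrow> real"
  assumes F: "convex_on C F" and y: "y \<in> C" and z: "z \<in> C" and diff: "F differentiable (at y)"
  shows "F y + gradient F y \<bullet> (z - y) \<le> F z"
proof -
  define p where "p s = F (y + s *\<^sub>R (z - y))" for s
  have "(p has_real_derivative gradient F y \<bullet> (z - y)) (at 0 within {0<..})"
    using DERIV_along_line[of F y 0 "z - y" "{0<..}"] diff by (simp add: p_def[abs_def])
  then have lim: "((\<lambda>s. (p s - p 0) / s) \<longlongrightarrow> gradient F y \<bullet> (z - y)) (at_right 0)"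
    by (simp add: has_field_derivative_iff)
  have "\<forall>\<^sub>F s in at_right 0. s < (1::real)"
    by (rule eventually_at_rightI[of 0 1]) auto
  moreover have "\<forall>\<^sub>F s in at_right 0. 0 < (s::real)" by (rule eventually_at_right_less)
  ultimately have "\<forall>\<^sub>F s in at_right 0. (p s - p 0) / s \<le> F z - F y"
  proof eventually_elim
    case (elim s)
    have "y + s *\<^sub>R (z - y) = (1 - s) *\<^sub>R y + s *\<^sub>R z" by (simp add: algebra_simps)
    then have "p s \<le> (1 - s) * F y + s * F z"
      using convex_onD[OF F, of s y z] elim y z by (simp add: p_def)
    then show ?case using elim by (simp add: p_def field_simps)
  qed
  then have "gradient F y \<bullet> (z - y) \<le> F z - F y"
    by (intro tendsto_upperbound[OF lim]) auto
  then show ?thesis by simp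
qed

lemma convex_hessian_inequality:
  fixes F :: "'a::euclidean_space \<Rightarrow> real"
  assumes U: "open U" "x \<in> U" and F: "\<And>y. y \<in> U \<Longrightarrow> F differentiable (at y)"
    and F2: "gradient F differentiable (at x)" and cv: "convex_on U F"
  shows "hessian F x w \<bullet> w + 2 * (hessian F x w \<bullet> u) \<le> hessian F x (w + u) \<bullet> (w + u)"
proof -
  define t :: "nat \<Rightarrow> real" where "t k = inverse (Suc k)" for k
  have t: "t k > 0" for k by (simp add: t_def)
  have t0: "t \<longlonglongrightarrow> 0" unfolding t_def by (rule LIMSEQ_inverse_real_of_nat)
  define Q where "Q v k = (F (x + t k *\<^sub>R v) - F x - gradient F x \<bullet> (t k *\<^sub>R v)) / (t k)\<^sup>2" for v k
  have Q: "Q v \<longlonglongrightarrow> (hessian F x v \<bullet> v) / 2" for v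
    unfolding Q_def using second_order_quotient_tendsto[OF U F F2 t t0 tendsto_const] by simp
  define G where "G k = (gradient F (x + t k *\<^sub>R w) - gradient F x) /\<^sub>R t k" for k
  have G: "G \<longlonglongrightarrow> hessian F x w"
  proof -
    have "((\<lambda>s. gradient F (x + s *\<^sub>R w)) has_derivative (\<lambda>s. hessian F x (s *\<^sub>R w))) (at 0)"
      using gradient_has_derivative_hessian[OF F2]
      by (intro has_derivative_compose[where f = "\<lambda>s. x + s *\<^sub>R w" and g = "gradient F"])
        (auto intro!: derivative_eq_intros)
    then have "((\<lambda>s. norm (gradient F (x + s *\<^sub>R w) - gradient F x - hessian F x (s *\<^sub>R w)) / norm s)
        \<longlongrightarrow> 0) (at 0)"
      by (simp add: has_derivative_at)
    moreover have "filterlim t (at 0) sequentially"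
      using t0 t by (auto simp: filterlim_at less_imp_neq[symmetric])
    ultimately have "(\<lambda>k. norm (gradient F (x + t k *\<^sub>R w) - gradient F x - hessian F x (t k *\<^sub>R w))
        / norm (t k)) \<longlonglongrightarrow> 0" by (rule filterlim_compose)
    also have "(\<lambda>k. norm (gradient F (x + t k *\<^sub>R w) - gradient F x - hessian F x (t k *\<^sub>R w))
        / norm (t k)) = (\<lambda>k. norm (G k - hessian F x w))"
    proof
      fix k
      have "G k - hessian F x w
          = (gradient F (x + t k *\<^sub>R w) - gradient F x - hessian F x (t k *\<^sub>R w)) /\<^sub>R t k"
        using t[of k] by (simp add: G_def blinfun.scaleR_right scaleR_diff_right)
      then show "norm (gradient F (x + t k *\<^sub>R w) - gradient F x - hessian F x (t k *\<^sub>R w))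
        / norm (t k) = norm (G k - hessian F x w)"
        by (simp add: divide_inverse_commute)
    qed
    finally show ?thesis using Lim_null tendsto_norm_zero_iff by blast
  qed
  have inU: "\<forall>\<^sub>F k in sequentially. x + t k *\<^sub>R v \<in> U" for v
  proof (rule topological_tendstoD)
    show "(\<lambda>k. x + t k *\<^sub>R v) \<longlonglongrightarrow> x"
      using tendsto_add[OF tendsto_const[of x] tendsto_scaleR[OF t0 tendsto_const[of v]]] by simp
  qed (use U in auto)
  have "\<forall>\<^sub>F k in sequentially. Q w k + G k \<bullet> u \<le> Q (w + u) k"
    using inU[of w] inU[of "w + u"]
  proof eventually_elim
    case (elim k)
    have "F (x + t k *\<^sub>R w) + gradient F (x + t k *\<^sub>R w) \<bullet> (t k *\<^sub>R u) \<le> F (x + t k *\<^sub>R (w + u))"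
      using convex_on_imp_above_gradient[OF cv elim F[OF elim(1)]] by (simp add: algebra_simps)
    moreover have "t k *\<^sub>R G k = gradient F (x + t k *\<^sub>R w) - gradient F x"
      using t[of k] by (simp add: G_def)
    then have "(t k)\<^sup>2 * (G k \<bullet> u) = (gradient F (x + t k *\<^sub>R w) - gradient F x) \<bullet> (t k *\<^sub>R u)"
      by (metis inner_scaleR_left inner_scaleR_right mult.assoc power2_eq_square)
    ultimately have "(F (x + t k *\<^sub>R w) - F x - gradient F x \<bullet> (t k *\<^sub>R w)
       + (t k)\<^sup>2 * (G k \<bullet> u)) / (t k)\<^sup>2 \<le> Q (w + u) k"
      unfolding Q_def using t[of k]
      by (intro divide_right_mono)
        (auto simp: algebra_simps inner_diff_left inner_add_right)
    then show ?case using t[of k] by (simp add: Q_def add_divide_distrib)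
  qed
  then have "hessian F x w \<bullet> w / 2 + hessian F x w \<bullet> u \<le> hessian F x (w + u) \<bullet> (w + u) / 2"
    by (intro tendsto_le[OF _ Q tendsto_add[OF Q tendsto_inner[OF G tendsto_const]]]) auto
  then show ?thesis by simp
qed

text \<open>Symmetry of the Hessian is not available here; the asymmetry of the inequality above replaces it.\<close>

lemma hessian_kernel_if_quadratic_form_zero:
  fixes F :: "'a::euclidean_space \<Rightarrow> real"
  assumes U: "open U" "x \<in> U" and F: "\<And>y. y \<in> U \<Longrightarrow> F differentiable (at y)"
    and F2: "gradient F differentiable (at x)" and cv: "convex_on U F"
    and w: "hessian F x w \<bullet> w \<le> 0"
  shows "hessian F x w = 0"
proof -
  note ineq = convex_hessian_inequality[OF U F F2 cv]
  let ?H = "hessian F x"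
  have nonneg: "0 \<le> ?H u \<bullet> u" for u using ineq[of 0 u] by (simp add: blinfun.zero_right)
  define u where "u = ?H w"
  define a b c where "a = ?H w \<bullet> u" and "b = ?H u \<bullet> w" and "c = ?H u \<bullet> u"
  have w0: "?H w \<bullet> w = 0" using w nonneg[of w] by simp
  have exp: "?H (w + s *\<^sub>R u) \<bullet> (w + s *\<^sub>R u) = s * (a + b) + s\<^sup>2 * c" for s
    by (simp add: blinfun.add_right blinfun.scaleR_right inner_add_left inner_add_right w0
        a_def b_def c_def power2_eq_square algebra_simps)
  have lin: "m = 0" if "\<And>s::real. 0 \<le> s * m + s\<^sup>2 * c" for m
  proof (rule ccontr)
    assume "m \<noteq> 0"
    have c: "c \<ge> 0" unfolding c_def by (rule nonneg)
    define s where "s = - m / (c + 1)"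
    have "m = - (c + 1) * s" using c by (simp add: s_def field_simps del: minus_add_distrib)
    then have "s * m + s\<^sup>2 * c = - s\<^sup>2"
      by (simp only: power2_eq_square) (simp add: left_diff_distrib right_diff_distrib)
    then have "0 \<le> - s\<^sup>2" using that[of s] by simp
    then show False using \<open>m \<noteq> 0\<close> c by (simp add: s_def)
  qed
  have "a + b = 0" using nonneg exp by (intro lin) metis
  moreover have "b - a = 0"
  proof (rule lin)
    fix s :: real
    have "2 * (s * a) \<le> s * (a + b) + s\<^sup>2 * c"
      using ineq[of w "s *\<^sub>R u"] unfolding exp w0 by (simp add: a_def)
    then show "0 \<le> s * (b - a) + s\<^sup>2 * c" by (simp add: algebra_simps)
  qed
  ultimately have "?H w \<bullet> ?H w = 0" by (simp add: a_def u_def)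
  then show ?thesis by simp
qed

section \<open>Epigraphs and conjugates\<close>

definition epi :: "('a \<Rightarrow> ereal) \<Rightarrow> ('a \<times> real) set" where
  "epi g = {p. g (fst p) \<le> ereal (snd p)}"

lemma closed_epi:
  fixes g :: "'a::metric_space \<Rightarrow> ereal"
  assumes "lower_semicontinuous g"
  shows "closed (epi g)"
proof -
  have "\<exists>A B. open A \<and> open B \<and> (y, r) \<in> A \<times> B \<and> A \<times> B \<subseteq> - epi g" if yr: "ereal r < g y" for y r
  proof -
    obtain s where s: "ereal r < ereal s" "ereal s < g y" using ereal_dense2[OF yr] by blast
    have "ereal s < Liminf (at y) g"
      using s(2) assms unfolding lower_semicontinuous_def by (metis less_le_trans)
    then have "\<forall>\<^sub>F z in at y. ereal s < g z" by (rule less_LiminfD)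
    then have "\<forall>\<^sub>F z in nhds y. ereal s < g z"
      using s(2) by (auto simp: eventually_at_filter elim!: eventually_mono)
    then obtain A where A: "open A" "y \<in> A" "\<And>z. z \<in> A \<Longrightarrow> ereal s < g z"
      unfolding eventually_nhds by blast
    have "\<not> g z \<le> ereal b" if "z \<in> A" "b < s" for z b
      using that A(3)[of z] less_trans[of "ereal b" "ereal s" "g z"] by simp
    with A(1,2) show ?thesis
      using s(1) by (intro exI[of _ A] exI[of _ "{..<s}"])
        (auto simp: epi_def)
  qed
  then have "open (- epi g)"
    by (intro open_prod_intro) (auto simp: epi_def not_le)
  then show ?thesis by (simp add: closed_def)
qed

lemma convex_epi:
  assumes "convex_efun g"
  shows "convex (epi g)"
proof (rule convexI)
  show "u *\<^sub>R p + v *\<^sub>R q \<in> epi g" if pq: "p \<in> epi g" "q \<in> epi g" and uv: "0 \<le> u" "0 \<le> v" "u + v = 1" for p q u v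
  proof (cases "u = 0 \<or> v = 0")
    case True
    then show ?thesis using pq uv by auto
  next
    case False
    with uv have uv: "0 < u" "0 < v" "u + v = 1" by auto
    have "g (u *\<^sub>R fst p + v *\<^sub>R fst q) \<le> ereal u * g (fst p) + ereal v * g (fst q)"
      using assms uv unfolding convex_efun_def by (smt (verit, best))
    also have "\<dots> \<le> ereal u * ereal (snd p) + ereal v * ereal (snd q)"
      using pq uv by (intro add_mono ereal_mult_left_mono) (auto simp: epi_def)
    finally show ?thesis by (simp add: epi_def)
  qed
qed

lemma real_epi:
  assumes "proper g" "g y \<noteq> \<infinity>"
  obtains r where "g y = ereal r" "(y, r) \<in> epi g"
  using assms by (cases "g y") (auto simp: proper_def epi_def)

lemma mem_subdifferential_iff_epi:
  assumes "proper g" "g x = ereal r"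
  shows "v \<in> subdifferential g x \<longleftrightarrow> (\<forall>(y, s) \<in> epi g. r + v \<bullet> (y - x) \<le> s)"
proof
  assume "v \<in> subdifferential g x"
  then have "ereal (r + v \<bullet> (y - x)) \<le> g y" for y
    using assms by (simp add: subdifferential_def)
  then show "\<forall>(y, s) \<in> epi g. r + v \<bullet> (y - x) \<le> s"
    unfolding epi_def by clarsimp (metis ereal_less_eq(3) order_trans)
next
  assume R: "\<forall>(y, s) \<in> epi g. r + v \<bullet> (y - x) \<le> s"
  have "ereal (r + v \<bullet> (y - x)) \<le> g y" for y
  proof (cases "g y = \<infinity>")
    case False
    then obtain s where "g y = ereal s" "(y, s) \<in> epi g" using real_epi[OF assms(1)] by blast
    with R show ?thesis by auto
  qed simp
  then show "v \<in> subdifferential g x" using assms(2) by (simp add: subdifferential_def)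
qed

lemma fenchel_conjugate_le_iff_epi:
  assumes "proper g"
  shows "fenchel_conjugate g v \<le> ereal B \<longleftrightarrow> (\<forall>(y, s) \<in> epi g. v \<bullet> y - s \<le> B)"
proof
  assume "fenchel_conjugate g v \<le> ereal B"
  then have le: "ereal (v \<bullet> y) - g y \<le> ereal B" for y
    unfolding fenchel_conjugate_def by (simp add: SUP_le_iff)
  have "v \<bullet> y - s \<le> B" if "(y, s) \<in> epi g" for y s
  proof -
    have "ereal (v \<bullet> y) - ereal s \<le> ereal (v \<bullet> y) - g y"
      using that by (intro ereal_minus_mono) (auto simp: epi_def)
    also note le
    finally show ?thesis by simp
  qed
  then show "\<forall>(y, s) \<in> epi g. v \<bullet> y - s \<le> B" by blast
next
  assume R: "\<forall>(y, s) \<in> epi g. v \<bullet> y - s \<le> B"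
  have "ereal (v \<bullet> y) - g y \<le> ereal B" for y
  proof (cases "g y = \<infinity>")
    case False
    then obtain s where "g y = ereal s" "(y, s) \<in> epi g" using real_epi[OF assms] by blast
    with R show ?thesis by auto
  qed simp
  then show "fenchel_conjugate g v \<le> ereal B"
    unfolding fenchel_conjugate_def by (simp add: SUP_le_iff)
qed

lemma subdifferential_fenchel_conjugate:
  fixes g :: "'a::euclidean_space \<Rightarrow> ereal"
  assumes g: "proper g" "lower_semicontinuous g" "convex_efun g"
  shows "subdifferential (fenchel_conjugate g) v = setmap_inverse (subdifferential g) v"
proof (intro equalityI subsetI)
  fix x assume "x \<in> setmap_inverse (subdifferential g) v"
  then have v: "v \<in> subdifferential g x" by (simp add: setmap_inverse_def)
  then obtain r where r: "g x = ereal r" by (auto simp: subdifferential_def)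
  have ge: "ereal (u \<bullet> x - r) \<le> fenchel_conjugate g u" for u
    using SUP_upper[of x UNIV "\<lambda>x. ereal (u \<bullet> x) - g x"] by (simp add: fenchel_conjugate_def r)
  have "fenchel_conjugate g v \<le> ereal (v \<bullet> x - r)"
    using v unfolding mem_subdifferential_iff_epi[OF g(1) r] fenchel_conjugate_le_iff_epi[OF g(1)]
    by (auto simp: inner_diff_right)
  with ge have "fenchel_conjugate g v = ereal (v \<bullet> x - r)" by (simp add: antisym)
  with ge show "x \<in> subdifferential (fenchel_conjugate g) v"
    by (simp add: subdifferential_def inner_diff_right inner_commute)
next
  fix x assume "x \<in> subdifferential (fenchel_conjugate g) v"
  then obtain c where c: "fenchel_conjugate g v = ereal c"
    and sub: "\<And>u. ereal (c + x \<bullet> (u - v)) \<le> fenchel_conjugate g u"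
    by (auto simp: subdifferential_def)
  have low: "v \<bullet> y - s \<le> c" if "(y, s) \<in> epi g" for y s
    using fenchel_conjugate_le_iff_epi[OF g(1), of v c] c that by auto
  have "(x, v \<bullet> x - c) \<in> epi g"
  proof (rule ccontr)
    assume "(x, v \<bullet> x - c) \<notin> epi g"
    then obtain a b where ab: "a \<bullet> (x, v \<bullet> x - c) < b" "\<And>p. p \<in> epi g \<Longrightarrow> b < a \<bullet> p"
      using separating_hyperplane_closed_point[OF convex_epi[OF g(3)] closed_epi[OF g(2)]] by blast
    obtain p q where a: "a = (p, q)" by fastforce
    have x: "p \<bullet> x + q * (v \<bullet> x - c) < b" using ab(1) by (simp add: a)
    have E: "b < p \<bullet> y + q * s" if "(y, s) \<in> epi g" for y s using ab(2)[OF that] by (simp add: a)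
    have q: "q \<ge> 0"
    proof (rule ccontr)
      assume "\<not> q \<ge> 0"
      obtain y s where ys: "(y, s) \<in> epi g"
        using g(1) real_epi[OF g(1)] unfolding proper_def edom_def
        by (metis (mono_tags, lifting) Collect_empty_eq less_irrefl)
      define s' where "s' = max s ((b - p \<bullet> y) / q)"
      have "(y, s') \<in> epi g" using ys by (auto simp: epi_def s'_def intro: order_trans)
      moreover have "q * s' \<le> q * ((b - p \<bullet> y) / q)"
        using \<open>\<not> q \<ge> 0\<close> by (intro mult_left_mono_neg) (auto simp: s'_def)
      ultimately show False using E[of y s'] \<open>\<not> q \<ge> 0\<close> by simp
    qed
    \<comment> \<open>Adding the affine minorant with slope \<open>v\<close> makes a possibly vertical separating hyperplane
      non-vertical.\<close>
    define u where "u = (v - p) /\<^sub>R (1 + q)"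
    have u: "(1 + q) *\<^sub>R u = v - p" using q by (simp add: u_def)
    have "fenchel_conjugate g u \<le> ereal ((c - b) / (1 + q))"
      unfolding fenchel_conjugate_le_iff_epi[OF g(1)]
    proof clarify
      fix y s assume ys: "(y, s) \<in> epi g"
      have "(1 + q) * (u \<bullet> y - s) = (v - p) \<bullet> y - (1 + q) * s"
        unfolding u[symmetric] by (simp add: right_diff_distrib)
      also have "\<dots> \<le> c - b" using low[OF ys] E[OF ys] by (simp add: inner_diff_left algebra_simps)
      finally show "u \<bullet> y - s \<le> (c - b) / (1 + q)" using q by (simp add: field_simps)
    qed
    with sub[of u] have "c + x \<bullet> (u - v) \<le> (c - b) / (1 + q)"
      using order_trans by fastforce
    then have "(1 + q) * (c + x \<bullet> (u - v)) \<le> c - b" using q by (simp add: field_simps)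
    moreover have "(1 + q) * (c + x \<bullet> (u - v)) = (1 + q) * c + x \<bullet> ((1 + q) *\<^sub>R u) - (1 + q) * (x \<bullet> v)"
      by (simp add: inner_diff_right algebra_simps)
    ultimately show False
      using x unfolding u by (simp add: inner_diff_right inner_commute algebra_simps)
  qed
  moreover from this obtain r where r: "g x = ereal r" "(x, r) \<in> epi g"
    using real_epi[OF g(1), of x] by (fastforce simp: epi_def)
  ultimately have "r = v \<bullet> x - c" using low[OF r(2)] by (simp add: epi_def)
  then have "v \<in> subdifferential g x"
    unfolding mem_subdifferential_iff_epi[OF g(1) r(1)]
    by (auto simp: inner_diff_right dest!: low)
  then show "x \<in> setmap_inverse (subdifferential g) v" by (simp add: setmap_inverse_def)
qed

section \<open>Proximal points and the error bound\<close>

lemma proximal_point: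
  fixes g :: "'a::euclidean_space \<Rightarrow> ereal"
  assumes g: "proper g" "lower_semicontinuous g" "convex_efun g"
    and x: "v \<in> subdifferential g x" "g x = ereal r" and y: "g y \<le> ereal s"
  obtains z where "v + (y - z) \<in> subdifferential g z"
    "(norm (z - y))\<^sup>2 \<le> 2 * (s - r - v \<bullet> (y - x))"
proof -
  define P where "P p = snd p - v \<bullet> fst p + (norm (fst p - y))\<^sup>2 / 2" for p
  define m L where "m = s - v \<bullet> y" and "L = r - v \<bullet> x"
  define C where "C = {p \<in> epi g. P p \<le> m}"
  have low: "L \<le> t - v \<bullet> z" if "(z, t) \<in> epi g" for z t
    using x that unfolding mem_subdifferential_iff_epi[OF g(1) x(2)]
    by (auto simp: L_def inner_diff_right)
  have contP: "continuous_on A P" for A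
    unfolding P_def by (intro continuous_intros) simp
  have near: "(norm (z - y))\<^sup>2 \<le> 2 * (m - L)" if "(z, t) \<in> C" for z t
    using low[of z t] that by (auto simp: C_def P_def)
  have ys: "(y, s) \<in> C" using y by (simp add: C_def P_def m_def epi_def)
  have "bounded C"
  proof -
    define R where "R = sqrt (2 * (m - L))"
    define M where "M = norm v * (norm y + R)"
    have "(z, t) \<in> cball y R \<times> {L - M .. m + M}" if zt: "(z, t) \<in> C" for z t
    proof -
      have zR: "norm (z - y) \<le> R" unfolding R_def using near[OF zt] by (rule real_le_rsqrt)
      have "\<bar>v \<bullet> z\<bar> \<le> norm v * norm z" by (rule Cauchy_Schwarz_ineq2)
      also have "\<dots> \<le> M" unfolding M_def
        using zR norm_triangle_sub[of z y] by (intro mult_left_mono) auto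
      finally have "\<bar>v \<bullet> z\<bar> \<le> M" .
      moreover have "t - v \<bullet> z \<le> m"
      proof -
        have "t - v \<bullet> z + (norm (z - y))\<^sup>2 / 2 \<le> m" using zt by (simp add: C_def P_def)
        moreover have "0 \<le> (norm (z - y))\<^sup>2 / 2" by simp
        ultimately show ?thesis by linarith
      qed
      moreover have "L \<le> t - v \<bullet> z" using zt low by (simp add: C_def)
      ultimately show ?thesis using zR by (auto simp: dist_norm norm_minus_commute)
    qed
    then have "C \<subseteq> cball y R \<times> {L - M .. m + M}" by auto
    then show ?thesis by (rule bounded_subset[rotated]) (intro bounded_Times bounded_cball bounded_closed_interval)
  qed
  moreover have "closed C"
  proof -
    have "C = epi g \<inter> (P -` {..m})" by (auto simp: C_def)
    moreover have "closed (P -` {..m})"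
      by (intro closed_vimage contP) simp
    ultimately show ?thesis using closed_epi[OF g(2)] by (simp add: closed_Int)
  qed
  ultimately have "compact C" by (simp add: compact_eq_bounded_closed)
  then have "\<exists>p\<in>C. \<forall>q\<in>C. P p \<le> P q"
    using ys by (intro continuous_attains_inf contP) auto
  then obtain p where p: "p \<in> C" "\<And>q. q \<in> C \<Longrightarrow> P p \<le> P q" by blast
  obtain z t where zt: "p = (z, t)" by fastforce
  have zt_epi: "(z, t) \<in> epi g" using p(1) by (simp add: zt C_def)
  have min: "P (z, t) \<le> P q" if "q \<in> epi g" for q
    using p(1) p(2)[of q] that by (cases "P q \<le> m") (auto simp: C_def zt)
  have ineq: "t + (v + (y - z)) \<bullet> (z' - z) \<le> t'" if q: "(z', t') \<in> epi g" for z' t'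
  proof -
    define A B where "A = t' - t - (v + (y - z)) \<bullet> (z' - z)" and "B = (norm (z' - z))\<^sup>2 / 2"
    have "0 \<le> A + \<tau> * B" if \<tau>: "0 < \<tau>" "\<tau> < 1" for \<tau>
    proof -
      have "(1 - \<tau>) *\<^sub>R (z, t) + \<tau> *\<^sub>R (z', t') \<in> epi g"
        using convex_epi[OF g(3)] zt_epi q \<tau> by (intro convexD) auto
      then have "P (z, t) \<le> P ((1 - \<tau>) *\<^sub>R (z, t) + \<tau> *\<^sub>R (z', t'))" by (rule min)
      also have "(1 - \<tau>) *\<^sub>R (z, t) + \<tau> *\<^sub>R (z', t') = (z + \<tau> *\<^sub>R (z' - z), t + \<tau> * (t' - t))"
        by (simp add: algebra_simps)
      also have "P \<dots> = P (z, t) + \<tau> * (A + \<tau> * B)"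
      proof -
        have "z + \<tau> *\<^sub>R (z' - z) - y = (z - y) + \<tau> *\<^sub>R (z' - z)" by simp
        then show ?thesis
          unfolding P_def A_def B_def fst_conv snd_conv
          by (simp only: power2_norm_eq_inner inner_add_left inner_add_right inner_scaleR_left
              inner_scaleR_right inner_diff_left inner_diff_right inner_commute[of z' z]
              inner_commute[of y z] inner_commute[of y z']) (simp add: field_simps inner_commute)
      qed
      finally show ?thesis using \<tau> by (simp add: zero_le_mult_iff)
    qed
    then have "\<forall>\<^sub>F \<tau> in at_right 0. 0 \<le> A + \<tau> * B" by (intro eventually_at_rightI[of 0 1]) auto
    moreover have "((\<lambda>\<tau>. A + \<tau> * B) \<longlongrightarrow> A + 0 * B) (at_right 0)" by (intro tendsto_intros)
    ultimately have "0 \<le> A + 0 * B" by (intro tendsto_lowerbound) auto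
    then show ?thesis by (simp add: A_def)
  qed
  obtain t' where t': "g z = ereal t'" "(z, t') \<in> epi g"
    using zt_epi real_epi[OF g(1), of z] by (fastforce simp: epi_def)
  have "t' = t" using ineq[OF t'(2)] zt_epi t'(1) by (simp add: epi_def)
  then have "v + (y - z) \<in> subdifferential g z"
    using ineq unfolding mem_subdifferential_iff_epi[OF g(1) t'(1)] by auto
  moreover have "(norm (z - y))\<^sup>2 \<le> 2 * (s - r - v \<bullet> (y - x))"
    using near[of z t] p(1) by (simp add: zt m_def L_def inner_diff_right)
  ultimately show ?thesis by (rule that)
qed

lemma metrically_subregular_imp_error_bound:
  fixes g :: "'a::euclidean_space \<Rightarrow> ereal"
  assumes g: "proper g" "lower_semicontinuous g" "convex_efun g"
    and sub: "metrically_subregular (subdifferential g) x v" and r: "g x = ereal r"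
  obtains \<eta> l where "0 < \<eta>" "0 < l"
    "\<And>y \<delta>. \<lbrakk>0 < \<delta>; norm (y - x) + \<delta> \<le> \<eta>; g y \<le> ereal (r + v \<bullet> (y - x) + \<delta>\<^sup>2 / 2)\<rbrakk>
      \<Longrightarrow> \<exists>p. v \<in> subdifferential g p \<and> norm (p - y) \<le> l * \<delta>"
proof -
  obtain \<eta> l where v: "v \<in> subdifferential g x" and \<eta>: "\<eta> > 0" and l: "l > 0"
    and dist: "\<And>y. y \<in> cball x \<eta> \<Longrightarrow>
      edist_set y (setmap_inverse (subdifferential g) v) \<le> ereal l * edist_set v (subdifferential g y)"
    using sub unfolding metrically_subregular_def by blast
  have "\<exists>p. v \<in> subdifferential g p \<and> norm (p - y) \<le> (l + 2) * \<delta>"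
    if \<delta>: "0 < \<delta>" and y: "norm (y - x) + \<delta> \<le> \<eta>" and gy: "g y \<le> ereal (r + v \<bullet> (y - x) + \<delta>\<^sup>2 / 2)"
    for y \<delta>
  proof -
    obtain z where z: "v + (y - z) \<in> subdifferential g z" "(norm (z - y))\<^sup>2 \<le> \<delta>\<^sup>2"
      using proximal_point[OF g v r gy] by auto
    have zy: "norm (z - y) \<le> \<delta>" using z(2) \<delta> by (simp add: power2_le_iff_abs_le)
    then have "z \<in> cball x \<eta>"
      using y norm_triangle_ineq[of "z - y" "y - x"] by (simp add: dist_norm norm_minus_commute)
    then have "edist_set z (setmap_inverse (subdifferential g) v)
        \<le> ereal l * edist_set v (subdifferential g z)" by (rule dist)
    also have "\<dots> \<le> ereal l * ereal (dist v (v + (y - z)))"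
      unfolding edist_set_def using l z(1) by (intro ereal_mult_left_mono INF_lower) auto
    also have "\<dots> \<le> ereal (l * \<delta>)"
      using l zy by (simp add: dist_norm norm_minus_commute)
    also have "\<dots> < ereal ((l + 1) * \<delta>)" using \<delta> by simp
    finally obtain p where p: "v \<in> subdifferential g p" "dist z p < (l + 1) * \<delta>"
      by (auto simp: edist_set_def INF_less_iff setmap_inverse_def)
    have "norm (p - y) \<le> norm (p - z) + norm (z - y)"
      using norm_triangle_ineq[of "p - z" "z - y"] by simp
    also have "\<dots> \<le> (l + 2) * \<delta>"
      using p(2) zy by (simp add: dist_norm norm_minus_commute algebra_simps)
    finally show ?thesis using p(1) by blast
  qed
  then show ?thesis using that[of \<eta> "l + 2"] \<eta> l by simp
qed

section \<open>Strong solutions\<close>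

lemma convex_on_real_of_ereal:
  assumes f: "proper f" "convex_efun f" and C: "convex C" "C \<subseteq> edom f"
  shows "convex_on C (\<lambda>x. real_of_ereal (f x))"
proof (rule convex_onI)
  have fin: "f x = ereal (real_of_ereal (f x))" if "x \<in> C" for x
    using that f(1) C(2) by (cases "f x") (auto simp: proper_def edom_def)
  fix t x y assume t: "0 < t" "t < (1::real)" and xy: "x \<in> C" "y \<in> C"
  have z: "(1 - t) *\<^sub>R x + t *\<^sub>R y \<in> C" using C(1) xy t by (simp add: convexD_alt)
  have "f ((1 - t) *\<^sub>R x + t *\<^sub>R y) \<le> ereal (1 - t) * f x + ereal t * f y"
    using f(2) t by (simp add: convex_efun_def)
  then show "real_of_ereal (f ((1 - t) *\<^sub>R x + t *\<^sub>R y))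
      \<le> (1 - t) * real_of_ereal (f x) + t * real_of_ereal (f y)"
    by (subst (asm) fin[OF z], subst (asm) fin[OF xy(1)], subst (asm) fin[OF xy(2)]) simp
qed (use C in simp)

lemma strong_solution_real:
  assumes "f x = ereal a" "g x = ereal b"
  shows "strong_solution (\<lambda>x. f x + g x) x \<longleftrightarrow>
    (\<exists>c>0. \<exists>\<epsilon>>0. \<forall>y\<in>cball x \<epsilon>. ereal (a + b + c * (norm (y - x))\<^sup>2) \<le> f y + g y)"
proof -
  have "ereal s \<le> z - (ereal a + ereal b) \<longleftrightarrow> ereal (a + b + s) \<le> z" for z s
    by (cases z) auto
  then show ?thesis by (simp add: strong_solution_def assms)
qed

theorem corollary3p4:
  fixes f g :: "'a::euclidean_space \<Rightarrow> ereal" and xbar vbar :: 'a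
  assumes "proper f" and "lower_semicontinuous f" and "convex_efun f"
    and "proper g" and "lower_semicontinuous g" and "convex_efun g"
    and "xbar \<in> interior (edom f) \<inter> edom g"
    and "is_minimizer (\<lambda>x. f x + g x) xbar"
    and "twice_continuously_differentiable_on (\<lambda>x. real_of_ereal (f x)) (interior (edom f))"
    and "vbar = - gradient (\<lambda>x. real_of_ereal (f x)) xbar"
    and "metrically_subregular (subdifferential g) xbar vbar"
  shows "strong_solution (\<lambda>x. f x + g x) xbar \<longleftrightarrow>
     blinfun_kernel (hessian (\<lambda>x. real_of_ereal (f x)) xbar) \<inter>
       contingent_cone (subdifferential (fenchel_conjugate g) vbar) xbar = {0}"
proof -
  define F where "F = (\<lambda>x. real_of_ereal (f x))"
  let ?H = "hessian F xbar"
  define K where "K = setmap_inverse (subdifferential g) vbar"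
  obtain \<rho> where \<rho>: "\<rho> > 0" "ball xbar \<rho> \<subseteq> interior (edom f)"
    using assms(7) open_contains_ball[of "interior (edom f)"] by auto
  define U where "U = ball xbar \<rho>"
  have U: "open U" "xbar \<in> U" "U \<subseteq> edom f"
    using \<rho> interior_subset by (auto simp: U_def)
  have fF: "f y = ereal (F y)" if "y \<in> U" for y
    using that U(3) assms(1) by (cases "f y") (auto simp: F_def proper_def edom_def)
  have diff: "F differentiable (at y)" "gradient F differentiable (at y)" if "y \<in> U" for y
    using assms(9) that \<rho>(2) unfolding F_def U_def twice_continuously_differentiable_on_def by auto
  have cv: "convex_on U F"
    unfolding F_def using assms U(3) by (intro convex_on_real_of_ereal) (auto simp: U_def)
  obtain r where r: "g xbar = ereal r"
    using assms(4,7) by (cases "g xbar") (auto simp: proper_def edom_def)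
  have vb: "gradient F xbar = - vbar" using assms(10) by (simp add: F_def)
  have v: "vbar \<in> subdifferential g xbar" using assms(11) by (simp add: metrically_subregular_def)
  have gK: "g y = ereal (r + vbar \<bullet> (y - xbar))" if "y \<in> K" for y
  proof -
    have y: "vbar \<in> subdifferential g y" using that by (simp add: K_def setmap_inverse_def)
    then obtain s where s: "g y = ereal s" by (auto simp: subdifferential_def)
    have "ereal (s + vbar \<bullet> (xbar - y)) \<le> ereal r" "ereal (r + vbar \<bullet> (y - xbar)) \<le> ereal s"
      using y v s r unfolding subdifferential_def by (metis (mono_tags, lifting) mem_Collect_eq plus_ereal.simps(1))+
    then show ?thesis using s by (simp add: inner_diff_right)
  qed
  note taylor = second_order_quotient_tendsto[OF U(1,2) diff(1) diff(2)[OF U(2)], unfolded vb]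
  have strong: "strong_solution (\<lambda>x. f x + g x) xbar \<longleftrightarrow>
      (\<exists>c>0. \<exists>\<epsilon>>0. \<forall>y\<in>cball xbar \<epsilon>. ereal (F xbar + r + c * (norm (y - xbar))\<^sup>2) \<le> f y + g y)"
    using fF[OF U(2)] r by (rule strong_solution_real)
  have "strong_solution (\<lambda>x. f x + g x) xbar \<longleftrightarrow> blinfun_kernel ?H \<inter> contingent_cone K xbar = {0}"
  proof
    assume "strong_solution (\<lambda>x. f x + g x) xbar"
    then obtain c \<epsilon> where c: "c > 0" "\<epsilon> > 0"
      and growth: "\<And>y. y \<in> cball xbar \<epsilon> \<Longrightarrow>
        ereal (F xbar + r + c * (norm (y - xbar))\<^sup>2) \<le> f y + g y"
      unfolding strong by blast
    have "w = 0" if ker: "?H w = 0" and cone: "w \<in> contingent_cone K xbar" for w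
    proof -
      obtain t u where t: "\<And>k. t k > 0" "t \<longlonglongrightarrow> 0" and u: "u \<longlonglongrightarrow> w"
        and inK: "\<And>k. xbar + t k *\<^sub>R u k \<in> K"
        using cone unfolding contingent_cone_def by blast
      have lim: "(\<lambda>k. xbar + t k *\<^sub>R u k) \<longlonglongrightarrow> xbar"
        using tendsto_add[OF tendsto_const tendsto_scaleR[OF t(2) u]] by simp
      have "\<forall>\<^sub>F k in sequentially. xbar + t k *\<^sub>R u k \<in> U \<inter> ball xbar \<epsilon>"
        using U c by (intro topological_tendstoD[OF lim]) auto
      then have "\<forall>\<^sub>F k in sequentially. c * (norm (u k))\<^sup>2
          \<le> (F (xbar + t k *\<^sub>R u k) - F xbar - (- vbar) \<bullet> (t k *\<^sub>R u k)) / (t k)\<^sup>2"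
      proof eventually_elim
        case (elim k)
        then have "c * (norm (t k *\<^sub>R u k))\<^sup>2 \<le> F (xbar + t k *\<^sub>R u k) - F xbar + vbar \<bullet> (t k *\<^sub>R u k)"
          using growth[of "xbar + t k *\<^sub>R u k"] fF[of "xbar + t k *\<^sub>R u k"] gK[OF inK[of k]] by simp
        then show ?case
          using t(1)[of k] by (simp add: power_mult_distrib field_simps)
      qed
      moreover have "(\<lambda>k. c * (norm (u k))\<^sup>2) \<longlonglongrightarrow> c * (norm w)\<^sup>2" by (intro tendsto_intros u)
      ultimately have "c * (norm w)\<^sup>2 \<le> (?H w \<bullet> w) / 2"
        by (intro tendsto_le[OF _ taylor[OF _ t u]]) auto
      then show ?thesis using ker c by (simp add: mult_le_0_iff)
    qed
    moreover have "0 \<in> contingent_cone K xbar"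
    proof -
      have "xbar \<in> K" using v by (simp add: K_def setmap_inverse_def)
      then show ?thesis unfolding contingent_cone_def
        using LIMSEQ_inverse_real_of_nat
        by (intro CollectI exI[of _ "\<lambda>k. inverse (real (Suc k))"] exI[of _ "\<lambda>_. 0"]) auto
    qed
    ultimately show "blinfun_kernel ?H \<inter> contingent_cone K xbar = {0}"
      by (auto simp: blinfun_kernel_def)
  next
    assume trivial: "blinfun_kernel ?H \<inter> contingent_cone K xbar = {0}"
    show "strong_solution (\<lambda>x. f x + g x) xbar"
    proof (rule ccontr)
      assume notstrong: "\<not> strong_solution (\<lambda>x. f x + g x) xbar"
      obtain \<eta> l where \<eta>: "0 < \<eta>" and l: "0 < l"
        and error: "\<And>y \<delta>. \<lbrakk>0 < \<delta>; norm (y - xbar) + \<delta> \<le> \<eta>;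
          g y \<le> ereal (r + vbar \<bullet> (y - xbar) + \<delta>\<^sup>2 / 2)\<rbrakk> \<Longrightarrow>
          \<exists>p. vbar \<in> subdifferential g p \<and> norm (p - y) \<le> l * \<delta>"
        using metrically_subregular_imp_error_bound[OF assms(4-6,11) r] by blast
      define e :: "nat \<Rightarrow> real" where "e k = inverse (Suc k)" for k
      have e: "0 < e k" "e k \<le> 1" for k by (auto simp: e_def field_simps)
      have e0: "e \<longlonglongrightarrow> 0" unfolding e_def by (rule LIMSEQ_inverse_real_of_nat)
      have "\<exists>h s. h \<noteq> 0 \<and> norm h \<le> e k \<and> norm h < \<rho> \<and> 2 * norm h \<le> \<eta> \<and> g (xbar + h) = ereal s
          \<and> F (xbar + h) + s < F xbar + r + (e k)\<^sup>2 / 2 * (norm h)\<^sup>2" for k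
      proof -
        define \<epsilon> where "\<epsilon> = min (e k) (min (\<rho> / 2) (\<eta> / 2))"
        have "(e k)\<^sup>2 / 2 > 0" "\<epsilon> > 0" using e(1)[of k] \<rho> \<eta> by (auto simp: \<epsilon>_def)
        then obtain y where y: "y \<in> cball xbar \<epsilon>"
          "f y + g y < ereal (F xbar + r + (e k)\<^sup>2 / 2 * (norm (y - xbar))\<^sup>2)"
          using notstrong unfolding strong not_ex not_le by (metis not_le)
        have n: "norm (y - xbar) \<le> \<epsilon>" using y(1) by (simp add: dist_norm norm_minus_commute)
        then have nr: "norm (y - xbar) < \<rho>" using \<rho>(1) by (auto simp: \<epsilon>_def)
        then have fy: "f y = ereal (F y)"
          by (intro fF) (simp add: U_def dist_norm norm_minus_commute)
        obtain s where s: "g y = ereal s"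
          using y(2) fy assms(4) by (cases "g y") (auto simp: proper_def)
        have "y \<noteq> xbar" using y(2) fy s r by auto
        then show ?thesis using n nr s y(2) fy
          by (intro exI[of _ "y - xbar"] exI[of _ s]) (auto simp: \<epsilon>_def)
      qed
      then obtain h s where h: "\<And>k. h k \<noteq> 0" "\<And>k. norm (h k) \<le> e k" "\<And>k. norm (h k) < \<rho>"
          "\<And>k. 2 * norm (h k) \<le> \<eta>"
        and gs: "\<And>k. g (xbar + h k) = ereal (s k)"
        and less: "\<And>k. F (xbar + h k) + s k < F xbar + r + (e k)\<^sup>2 / 2 * (norm (h k))\<^sup>2"
        by metis
      have hU: "xbar + h k \<in> U" for k using h(3)[of k] by (simp add: U_def dist_norm)
      have f_lower: "F xbar - vbar \<bullet> h k \<le> F (xbar + h k)" for k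
        using convex_on_imp_above_gradient[OF cv U(2) hU diff(1)[OF U(2)]] by (simp add: vb)
      have g_lower: "r + vbar \<bullet> h k \<le> s k" for k
        using v gs[of k] r unfolding subdifferential_def
        by (auto dest!: spec[of _ "xbar + h k"])
      define t where "t k = norm (h k)" for k
      have t: "t k > 0" for k using h(1) by (simp add: t_def)
      have t0: "t \<longlonglongrightarrow> 0"
        by (rule tendsto_sandwich[OF _ _ tendsto_const e0]) (auto simp: t_def h(2))
      have "\<exists>p. p \<in> K \<and> norm (p - (xbar + h k)) \<le> l * (e k * t k)" for k
      proof -
        have "e k * norm (h k) \<le> 1 * norm (h k)" using e[of k] by (intro mult_right_mono) auto
        then have "norm (h k) + e k * t k \<le> \<eta>" using h(4)[of k] by (simp add: t_def)
        then show ?thesis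
          using error[of "e k * t k" "xbar + h k"] less[of k] f_lower[of k] e[of k] t[of k] gs[of k]
          by (auto simp: K_def setmap_inverse_def t_def power_mult_distrib)
      qed
      then obtain p where p: "\<And>k. p k \<in> K" "\<And>k. norm (p k - (xbar + h k)) \<le> l * (e k * t k)"
        by metis
      define d where "d k = h k /\<^sub>R t k" for k
      have "d k \<in> sphere 0 1" for k using t[of k] by (simp add: d_def t_def)
      then obtain w q where w: "w \<in> sphere 0 1" and q: "strict_mono q" and dw: "(d \<circ> q) \<longlonglongrightarrow> w"
        using compact_sphere[of "0::'a" 1] unfolding compact_def by metis
      note tq = t0[THEN LIMSEQ_subseq_LIMSEQ, OF q] and eq = e0[THEN LIMSEQ_subseq_LIMSEQ, OF q]
      define u where "u k = (p k - xbar) /\<^sub>R t k" for k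
      have "norm (u k - d k) \<le> l * e k" for k
      proof -
        have "u k - d k = (p k - (xbar + h k)) /\<^sub>R t k"
          by (simp add: u_def d_def algebra_simps)
        then have "norm (u k - d k) = norm (p k - (xbar + h k)) / t k"
          using t[of k] by (simp add: divide_inverse_commute)
        then show ?thesis using p(2)[of k] t[of k] by (simp add: pos_divide_le_eq mult.assoc)
      qed
      moreover have "(\<lambda>k. l * e k) \<longlonglongrightarrow> 0" using tendsto_mult[OF tendsto_const[of l] e0] by simp
      ultimately have ud: "(\<lambda>k. u k - d k) \<longlonglongrightarrow> 0"
        using Lim_null_comparison[of "\<lambda>k. u k - d k" "\<lambda>k. l * e k" sequentially] by simp
      have "(\<lambda>k. ((\<lambda>k. u k - d k) \<circ> q) k + (d \<circ> q) k) \<longlonglongrightarrow> 0 + w"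
        by (rule tendsto_add[OF LIMSEQ_subseq_LIMSEQ[OF ud q] dw])
      then have "(u \<circ> q) \<longlonglongrightarrow> w" by (simp add: o_def)
      then have "w \<in> contingent_cone K xbar"
        unfolding contingent_cone_def using t tq p(1)
        by (intro CollectI exI[of _ "t \<circ> q"] exI[of _ "u \<circ> q"])
          (auto simp: u_def less_imp_neq[symmetric])
      moreover have "?H w = 0"
      proof (rule hessian_kernel_if_quadratic_form_zero[OF U(1,2) diff(1) diff(2)[OF U(2)] cv])
        define Q where "Q k = (F (xbar + t k *\<^sub>R d k) - F xbar - (- vbar) \<bullet> (t k *\<^sub>R d k)) / (t k)\<^sup>2" for k
        have Q: "Q k \<le> (e k)\<^sup>2 / 2" for k
        proof -
          have "t k *\<^sub>R d k = h k" using t[of k] by (simp add: d_def)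
          then show ?thesis
            using less[of k] g_lower[of k] t[of k] by (simp add: Q_def t_def pos_divide_le_eq)
        qed
        have "(\<lambda>k. Q (q k)) \<longlonglongrightarrow> (?H w \<bullet> w) / 2"
          using taylor[OF _ _ tq dw] t by (simp add: Q_def)
        moreover have "(\<lambda>k. (e (q k))\<^sup>2 / 2) \<longlonglongrightarrow> 0\<^sup>2 / 2"
          using eq by (intro tendsto_intros) (auto simp: o_def)
        ultimately have "(?H w \<bullet> w) / 2 \<le> 0\<^sup>2 / 2" by (rule LIMSEQ_le) (use Q in blast)
        then show "?H w \<bullet> w \<le> 0" by simp
      qed
      ultimately have "w = 0" using trivial by (auto simp: blinfun_kernel_def)
      with w show False by simp
    qed
  qed
  then show ?thesis
    using subdifferential_fenchel_conjugate[OF assms(4-6)] by (simp add: F_def K_def)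
qed

end
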